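(* Consider the doubling map $T(x)=2x\bmod1$ with Lebesgue measure $\mu$ and the observable $\phi(x)=d(x,0)^{-\alpha}$, $\alpha>0$. For an integer $k\ge1$ let $M_n=\max_{0\le j\le n}\phi(T^jx)$ and $B_n=\max_{0\le j\le n}Y_j$, where $Y_j(x)=\frac1k\sum_{i=j}^{j+k-1}\phi(T^ix)$. If $M_n$ has GEV with parameters $\xi_1$ (shape), $\sigma_1$ (scale) and $\mu_1$ (location), then $B_n$ has GEV with parameters $$\mu_2=\frac{c(k)\mu_1}{k},\qquad \sigma_2=\frac{c(k)\sigma_1}{k},\qquad \xi_2=\xi_1,$$ where $c(k)$ is a function of $k$ satisfying $c_l<c(k)<c_u$ for all $k$, for uniform constants $c_l,c_u>0$ (independent of $k$).
   Context: The interval is viewed as the circle $[0,1]/(0\sim1)$ and $d$ is the circle distance, so $d(x,0)=\min(x,1-x)$. The symbol $\mu$ without subscript is Lebesgue measure; $\mu_1,\mu_2$ are location parameters. The GEV distribution with shape $\xi>0$, scale $\sigma>0$, location $m'$ is $z\mapsto\exp\{-[1+\xi(\frac{z-m'}{\sigma})]^{-1/\xi}\}$ on $\{1+\xi(z-m')/\sigma>0\}$. "A maximal process $Z_n$ has GEV with parameters $\xi,\sigma,m'$" (for fixed large $n$; $\sigma,m'$ depend on $n$) means in the present Fréchet case: there are $c_n>0$ and $\theta\in(0,1]$ with $\mu(Z_n\le c_nt)\to G^\theta(t)$ as $n\to\infty$ for all $t>0$, where $G(t)=\exp(-t^{-1/\xi})$, and the approximating law $z\mapsto G^\theta(z/c_n)$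 of $Z_n$ is the GEV distribution with parameters $\xi,\sigma,m'$. The parameters of $M_n$ and $B_n$ are compared at the same $n$. *)

theory Defs
  imports "HOL-Analysis.Analysis"
begin

text \<open>
  The circle \<open>[0,1]/(0\<sim>1)\<close> is represented by the fundamental domain \<open>{0..<1}\<close>.
\<close>

definition circle_measure :: "real measure" where
  "circle_measure = lebesgue_on {0..<1}"

definition circle_dist :: "real \<Rightarrow> real \<Rightarrow> real" where
  "circle_dist x y = min \<bar>x - y\<bar> (1 - \<bar>x - y\<bar>)"

definition doubling :: "real \<Rightarrow> real" where
  "doubling x = frac (2 * x)"

text \<open>
  Here \<open>0 powr (-\<alpha>) = 0\<close>, so the observable takes the value 0 instead of \<open>\<infinity>\<close> at the point 0.
  This concerns only the null set of points whose orbit meets 0 (the dyadic rationals).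
\<close>

definition observable :: "real \<Rightarrow> real \<Rightarrow> real" where
  "observable \<alpha> x = circle_dist x 0 powr (- \<alpha>)"

definition max_process :: "real \<Rightarrow> nat \<Rightarrow> real \<Rightarrow> real" where
  "max_process \<alpha> n x = Max ((\<lambda>j. observable \<alpha> ((doubling ^^ j) x)) ` {0..n})"

definition window_average :: "real \<Rightarrow> nat \<Rightarrow> nat \<Rightarrow> real \<Rightarrow> real" where
  "window_average \<alpha> k j x = (1 / real k) * (\<Sum>i=j..<j + k. observable \<alpha> ((doubling ^^ i) x))"

definition block_max_process :: "real \<Rightarrow> nat \<Rightarrow> nat \<Rightarrow> real \<Rightarrow> real" where
  "block_max_process \<alpha> k n x = Max ((\<lambda>j. window_average \<alpha> k j x) ` {0..n})"

text \<open>
  Both laws below are distribution functions on the whole line, hence 0 to the left of their support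
  (\<open>\<xi> > 0\<close>).
\<close>

definition frechet_cdf :: "real \<Rightarrow> real \<Rightarrow> real" where
  "frechet_cdf \<xi> t = (if t > 0 then exp (- (t powr (- 1 / \<xi>))) else 0)"

definition gev_cdf :: "real \<Rightarrow> real \<Rightarrow> real \<Rightarrow> real \<Rightarrow> real" where
  "gev_cdf \<xi> \<sigma> m z =
     (if 1 + \<xi> * ((z - m) / \<sigma>) > 0
      then exp (- ((1 + \<xi> * ((z - m) / \<sigma>)) powr (- 1 / \<xi>))) else 0)"

text \<open>
  Scale and location depend on \<open>n\<close>, so they are sequences; they are the parameters of the
  approximating law of \<open>Z n\<close> for every \<open>n \<ge> N\<close>. The normalising sequence \<open>c\<close> and the exponent \<open>\<theta>\<close>
  in the limit law and in the approximating laws are the same.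
\<close>

definition has_gev ::
  "nat \<Rightarrow> (nat \<Rightarrow> real \<Rightarrow> real) \<Rightarrow> real \<Rightarrow> (nat \<Rightarrow> real) \<Rightarrow> (nat \<Rightarrow> real) \<Rightarrow> bool" where
  "has_gev N Z \<xi> \<sigma> m \<longleftrightarrow>
     \<xi> > 0 \<and> (\<forall>n\<ge>N. \<sigma> n > 0) \<and>
     (\<exists>c \<theta>. (\<forall>n. c n > 0) \<and> 0 < \<theta> \<and> \<theta> \<le> 1 \<and>
        (\<forall>t>0. (\<lambda>n. measure circle_measure {x \<in> space circle_measure. Z n x \<le> c n * t})
                  \<longlonglongrightarrow> frechet_cdf \<xi> t powr \<theta>) \<and>
        (\<forall>n\<ge>N. \<forall>z. frechet_cdf \<xi> (z / c n) powr \<theta> = gev_cdf \<xi> (\<sigma> n) (m n) z))"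

end

theory Submission
  imports Defs
begin

text \<open>
  With \<open>S k = (\<Sum>i<k. 2 powr (-\<alpha> i))\<close>, both processes are compared pathwise: a window that starts
  at the orbit point closest to the fixed point 0 gives \<open>S k * M n \<le> k * B n\<close> almost surely, and a
  window sum exceeds \<open>S k\<close> times its largest term by at most a constant, because an orbit can
  jump into a small neighbourhood of 0 only from far away. Since \<open>M n \<rightarrow> \<infinity>\<close> almost surely, the
  normalising constants of \<open>M n\<close> tend to infinity and make the constant negligible, so \<open>k * B n\<close> and
  \<open>S k * M n\<close> have the same limit law. Hence \<open>c(k) = S k\<close>; the value of the extremal index plays
  no role.
\<close>

section \<open>Lebesgue measure and the doubling map\<close>

lemma space_circle_measure [simp]: "space circle_measure = {0..<1}"
  by (simp add: circle_measure_def)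

lemma measure_circle_measure:
  assumes "A \<subseteq> {0..<1}"
  shows "measure circle_measure A = measure lebesgue A"
  unfolding circle_measure_def by (rule measure_restrict_space) (use assms in auto)

interpretation circle: finite_measure circle_measure
proof
  have "emeasure circle_measure (space circle_measure) = emeasure lborel {0..<1::real}"
    unfolding space_circle_measure unfolding circle_measure_def
    by (subst emeasure_restrict_space) auto
  then show "emeasure circle_measure (space circle_measure) \<noteq> \<infinity>"
    by simp
qed

lemma borel_measurable_circle_measure:
  assumes "f \<in> borel_measurable borel"
  shows "f \<in> borel_measurable circle_measure"
  unfolding circle_measure_def
  using assms by (intro measurable_restrict_space1 measurable_completion) simp

lemma sets_circle_measure_borel:
  assumes "A \<in> sets borel" "A \<subseteq> {0..<1}"
  shows "A \<in> sets circle_measure"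
  using assms by (auto simp: circle_measure_def sets_restrict_space_iff)

lemma null_sets_circle_measure_singleton: "x \<in> {0..<1} \<Longrightarrow> {x} \<in> null_sets circle_measure"
  by (auto simp: null_sets_restrict_space circle_measure_def)

lemma borel_measurable_doubling [measurable]: "doubling \<in> borel_measurable borel"
  unfolding doubling_def[abs_def] frac_def by measurable

lemma borel_measurable_doubling_funpow [measurable]: "(doubling ^^ j) \<in> borel_measurable borel"
  by (induction j) auto

lemma borel_measurable_observable [measurable]: "observable \<alpha> \<in> borel_measurable borel"
  unfolding observable_def[abs_def] circle_dist_def by measurable

lemma borel_measurable_max_process: "max_process \<alpha> n \<in> borel_measurable borel"
  unfolding max_process_def[abs_def] by measurable

lemma borel_measurable_block_max_process: "block_max_process \<alpha> k n \<in> borel_measurable borel"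
  unfolding block_max_process_def[abs_def] window_average_def by measurable

lemma doubling_mem: "doubling x \<in> {0..<1}"
  by (simp add: doubling_def frac_lt_1)

lemma doubling_funpow_mem: "x \<in> {0..<1} \<Longrightarrow> (doubling ^^ j) x \<in> {0..<1}"
  by (cases j) (use doubling_mem in auto)

lemma doubling_eq:
  assumes "x \<in> {0..<1}"
  shows "doubling x = (if x < 1/2 then 2 * x else 2 * x - 1)"
proof (cases "x < 1 / 2")
  case True
  then show ?thesis using assms by (simp add: doubling_def frac_eq)
next
  case False
  then have "\<lfloor>2 * x\<rfloor> = 1" using assms by (simp add: floor_eq_iff)
  then show ?thesis using False by (simp add: doubling_def frac_def)
qed

section \<open>Invariance of Lebesgue measure under the doubling map\<close>

lemma measure_lebesgue_real_affine:
  fixes S :: "real set"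
  shows "measure lebesgue ((\<lambda>x. m * x + d) ` S) = \<bar>m\<bar> * measure lebesgue S"
  using measure_lebesgue_affine[of m d S] by simp

text \<open>The preimage splits at 1/2 into two affine copies of the set, each scaled by 1/2, so the
  two measures add up to the original one.\<close>

lemma measure_doubling_vimage:
  assumes "E \<in> sets borel"
  shows "measure circle_measure {x\<in>{0..<1}. doubling x \<in> E} = measure circle_measure ({0..<1} \<inter> E)"
proof -
  define F where "F = {0..<1} \<inter> E"
  have [measurable]: "E \<in> sets borel" by fact
  let ?A = "{x\<in>{0..<1/2}. doubling x \<in> E}" and ?B = "{x\<in>{1/2..<1}. doubling x \<in> E}"
  have sets: "?A \<in> sets circle_measure" "?B \<in> sets circle_measure"
    by (rule sets_circle_measure_borel; force)+
  have "?A = (\<lambda>x. 1/2 * x + 0) ` F"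
  proof (intro set_eqI iffI)
    fix x assume "x \<in> ?A"
    then show "x \<in> (\<lambda>x. 1/2 * x + 0) ` F"
      by (intro image_eqI[of _ _ "2 * x"]) (auto simp: doubling_eq F_def)
  qed (auto simp: doubling_eq F_def)
  then have A: "measure lebesgue ?A = 1/2 * measure lebesgue F"
    by (simp only: measure_lebesgue_real_affine)
  have "?B = (\<lambda>x. 1/2 * x + 1/2) ` F"
  proof (intro set_eqI iffI)
    fix x assume "x \<in> ?B"
    then show "x \<in> (\<lambda>x. 1/2 * x + 1/2) ` F"
      by (intro image_eqI[of _ _ "2 * x - 1"]) (auto simp: doubling_eq F_def field_simps)
  qed (auto simp: doubling_eq F_def)
  then have B: "measure lebesgue ?B = 1/2 * measure lebesgue F"
    by (simp only: measure_lebesgue_real_affine)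
  have "{x\<in>{0..<1}. doubling x \<in> E} = ?A \<union> ?B" by auto
  moreover have "?A \<inter> ?B = {}" by auto
  ultimately have "measure circle_measure {x\<in>{0..<1}. doubling x \<in> E}
      = measure circle_measure ?A + measure circle_measure ?B"
    using circle.finite_measure_Union[OF sets] by (simp only:)
  also have "\<dots> = measure lebesgue ?A + measure lebesgue ?B"
    by (intro arg_cong2[where f = "(+)"] measure_circle_measure) auto
  also have "\<dots> = measure circle_measure F"
    unfolding A B by (subst measure_circle_measure) (auto simp: F_def)
  finally show ?thesis unfolding F_def .
qed

lemma measure_doubling_funpow_vimage:
  assumes "E \<in> sets borel"
  shows "measure circle_measure {x\<in>{0..<1}. (doubling ^^ j) x \<in> E}
    = measure circle_measure ({0..<1} \<inter> E)"
proof (induction j)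
  case 0
  then show ?case by (auto intro: arg_cong[where f = "measure circle_measure"])
next
  case (Suc j)
  have [measurable]: "E \<in> sets borel" by fact
  have E: "(doubling ^^ j) -` E \<in> sets borel"
    using measurable_sets[of "doubling ^^ j" borel borel E] by simp
  have "{x\<in>{0..<1}. (doubling ^^ Suc j) x \<in> E}
      = {x\<in>{0..<1}. doubling x \<in> (doubling ^^ j) -` E}"
    by (simp only: funpow_Suc_right o_apply vimage_eq)
  then have "measure circle_measure {x\<in>{0..<1}. (doubling ^^ Suc j) x \<in> E}
      = measure circle_measure ({0..<1} \<inter> (doubling ^^ j) -` E)"
    using measure_doubling_vimage[OF E] by simp
  also have "{0..<1} \<inter> (doubling ^^ j) -` E = {x\<in>{0..<1}. (doubling ^^ j) x \<in> E}" by auto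
  finally show ?case using Suc by simp
qed

text \<open>By invariance each of the countably many exceptional sets has the measure of {0}. They
  contain the orbits that meet the default value of \<open>observable\<close> at 0.\<close>

lemma AE_orbit_nonzero: "AE x in circle_measure. \<forall>j. (doubling ^^ j) x \<noteq> 0"
proof -
  have "AE x in circle_measure. (doubling ^^ j) x \<noteq> 0" for j
  proof (rule AE_I)
    show "{x \<in> space circle_measure. \<not> (doubling ^^ j) x \<noteq> 0} \<subseteq> {x\<in>{0..<1}. (doubling ^^ j) x \<in> {0}}"
      by auto
    show "{x\<in>{0..<1}. (doubling ^^ j) x \<in> {0}} \<in> sets circle_measure"
      by (rule sets_circle_measure_borel) (measurable, auto)
    have "measure circle_measure {x\<in>{0..<1}. (doubling ^^ j) x \<in> {0}} = measure circle_measure {0}"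
      by (subst measure_doubling_funpow_vimage) auto
    also have "\<dots> = 0"
      using null_sets_circle_measure_singleton[of 0] by (simp add: measure_eq_0_null_sets)
    finally show "emeasure circle_measure {x\<in>{0..<1}. (doubling ^^ j) x \<in> {0}} = 0"
      by (simp add: circle.emeasure_eq_measure)
  qed
  then show ?thesis by (simp add: AE_all_countable)
qed

lemma doubling_funpow_near_0:
  assumes "0 \<le> x" "x < 1 / 2 ^ p"
  shows "(doubling ^^ p) x = 2 ^ p * x"
  using assms
proof (induction p arbitrary: x)
  case (Suc p)
  have "1 * (2 * x) \<le> 2 ^ p * (2 * x)"
    using Suc.prems by (intro mult_right_mono) auto
  moreover have "2 ^ p * (2 * x) < 1"
    using Suc.prems by (simp add: field_simps)
  ultimately have "x < 1 / 2" by simp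
  then have "doubling x = 2 * x"
    using Suc.prems by (simp add: doubling_eq)
  then show ?case
    using Suc.IH[of "2 * x"] Suc.prems
    by (simp only: funpow_Suc_right o_apply) (simp add: field_simps)
qed auto

section \<open>Window sums of the observable\<close>

lemma observable_eq:
  assumes "x \<in> {0..<1}"
  shows "observable \<alpha> x = min x (1 - x) powr (- \<alpha>)"
  using assms by (simp add: observable_def circle_dist_def)

text \<open>Within distance 1/4 of 0 the circle distance is doubled exactly, since the doubled value
  is still at most 1/2.\<close>

lemma observable_doubling_near_0:
  assumes "x \<in> {0..<1}" "min x (1 - x) \<le> 1/4"
  shows "observable \<alpha> (doubling x) = 2 powr (- \<alpha>) * observable \<alpha> x"
proof -
  have "min (doubling x) (1 - doubling x) = 2 * min x (1 - x)"
    using assms by (auto simp: doubling_eq min_def)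
  then show ?thesis
    using assms doubling_mem[of x] by (simp add: observable_eq powr_mult)
qed

text \<open>The distance to 0 at most doubles, and the negative exponent reverses the inequality. If
  \<open>doubling x\<close> were 0, the left-hand side would be the default value 0.\<close>

lemma observable_doubling_ge:
  assumes "\<alpha> > 0" "x \<in> {0..<1}" "doubling x \<noteq> 0"
  shows "observable \<alpha> (doubling x) \<ge> 2 powr (- \<alpha>) * observable \<alpha> x"
proof -
  have "0 < min (doubling x) (1 - doubling x)"
    using doubling_mem[of x] assms by auto
  moreover have "min (doubling x) (1 - doubling x) \<le> 2 * min x (1 - x)"
    using assms by (auto simp: doubling_eq min_def)
  ultimately have "(2 * min x (1 - x)) powr (- \<alpha>) \<le> min (doubling x) (1 - doubling x) powr (- \<alpha>)"
    using assms by (intro powr_mono2') auto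
  then show ?thesis
    using assms doubling_mem[of x] by (simp add: observable_eq powr_mult)
qed

text \<open>Unnormalised and started at an arbitrary point \<open>y\<close>, so that an induction on
  \<open>k\<close> can move the start to \<open>doubling y\<close>.\<close>

definition window_sum :: "real \<Rightarrow> nat \<Rightarrow> real \<Rightarrow> real" where
  "window_sum \<alpha> k y = (\<Sum>i<k. observable \<alpha> ((doubling ^^ i) y))"

text \<open>This is the constant c(k) of the theorem: while an orbit leaves 0 by exact doubling, the
  observable decays with ratio \<open>2 powr (- \<alpha>)\<close>.\<close>

definition window_factor :: "real \<Rightarrow> nat \<Rightarrow> real" where
  "window_factor \<alpha> k = (\<Sum>i<k. (2 powr (- \<alpha>)) ^ i)"

lemma window_average_eq:
  "window_average \<alpha> k j x = window_sum \<alpha> k ((doubling ^^ j) x) / real k"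
proof -
  have "(\<Sum>i=j..<j + k. observable \<alpha> ((doubling ^^ i) x))
      = (\<Sum>i=0..<k. observable \<alpha> ((doubling ^^ (i + j)) x))"
    using sum.shift_bounds_nat_ivl[of "\<lambda>i. observable \<alpha> ((doubling ^^ i) x)" 0 j k]
    by (simp add: add.commute)
  then show ?thesis
    by (simp add: window_average_def window_sum_def funpow_add atLeast0LessThan)
qed

lemma window_sum_Suc:
  "window_sum \<alpha> (Suc k) y = observable \<alpha> y + window_sum \<alpha> k (doubling y)"
  unfolding window_sum_def
  by (subst sum.lessThan_Suc_shift) (simp add: funpow_Suc_right del: funpow.simps)

lemma window_factor_nonneg: "window_factor \<alpha> k \<ge> 0"
  by (simp add: window_factor_def sum_nonneg)

lemma window_factor_Suc: "window_factor \<alpha> (Suc k) = 1 + 2 powr (- \<alpha>) * window_factor \<alpha> k"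
  unfolding window_factor_def
  by (subst sum.lessThan_Suc_shift) (simp add: sum_distrib_left)

lemma window_factor_ge_1: "k \<ge> 1 \<Longrightarrow> window_factor \<alpha> k \<ge> 1"
  by (cases k) (auto simp: window_factor_Suc window_factor_nonneg)

text \<open>A partial sum stays strictly below the full geometric series, which gives an upper bound
  uniform in \<open>k\<close>.\<close>

lemma window_factor_less:
  assumes "\<alpha> > 0"
  shows "window_factor \<alpha> k < 1 / (1 - 2 powr (- \<alpha>))"
proof -
  have q: "2 powr (- \<alpha>) < 1" using assms powr_less_one[of 2 "-\<alpha>"] by simp
  have "window_factor \<alpha> k = (1 - (2 powr (- \<alpha>)) ^ k) / (1 - 2 powr (- \<alpha>))"
    unfolding window_factor_def using q by (subst sum_gp_strict) auto
  also have "\<dots> < 1 / (1 - 2 powr (- \<alpha>))"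
    using q by (intro divide_strict_right_mono) auto
  finally show ?thesis .
qed

text \<open>Each step loses at most a factor \<open>2 powr (- \<alpha>)\<close>, so the terms
  dominate a geometric sequence that starts at \<open>observable \<alpha> y\<close>.\<close>

lemma window_sum_ge:
  assumes "\<alpha> > 0" "y \<in> {0..<1}" "\<And>j. (doubling ^^ j) y \<noteq> 0"
  shows "window_factor \<alpha> k * observable \<alpha> y \<le> window_sum \<alpha> k y"
  using assms(2,3)
proof (induction k arbitrary: y)
  case 0
  then show ?case by (simp add: window_factor_def window_sum_def)
next
  case (Suc k)
  have nz: "(doubling ^^ j) (doubling y) \<noteq> 0" for j
    using Suc.prems(2)[of "Suc j"] by (simp only: funpow_Suc_right o_apply) simp
  have "window_factor \<alpha> k * (2 powr (- \<alpha>) * observable \<alpha> y)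
      \<le> window_factor \<alpha> k * observable \<alpha> (doubling y)"
    using observable_doubling_ge[OF assms(1) Suc.prems(1)] nz[of 0]
    by (intro mult_left_mono) (auto simp: window_factor_nonneg)
  also have "\<dots> \<le> window_sum \<alpha> k (doubling y)"
    using Suc.IH[OF doubling_mem nz] by simp
  finally show ?case
    by (simp add: window_sum_Suc window_factor_Suc algebra_simps)
qed

text \<open>The start is so close to 0 that the distance is still at most 1/4 before each of the
  \<open>k\<close> doublings, hence the decay is exactly geometric.\<close>

lemma window_sum_near_0:
  assumes "y \<in> {0..<1}" "min y (1 - y) \<le> 1 / 2 ^ Suc k"
  shows "window_sum \<alpha> k y = window_factor \<alpha> k * observable \<alpha> y"
  using assms
proof (induction k arbitrary: y)
  case 0
  then show ?case by (simp add: window_factor_def window_sum_def)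
next
  case (Suc k)
  have "(1::real) / 2 ^ Suc (Suc k) \<le> 1 / 4" by (simp add: field_simps)
  then have le: "min y (1 - y) \<le> 1/4" using Suc.prems by linarith
  have "min (doubling y) (1 - doubling y) = 2 * min y (1 - y)"
    using le Suc.prems(1) by (auto simp: doubling_eq min_def)
  also have "\<dots> \<le> 1 / 2 ^ Suc k"
    using Suc.prems(2) by (simp add: field_simps)
  finally have "window_sum \<alpha> k (doubling y) = window_factor \<alpha> k * observable \<alpha> (doubling y)"
    by (intro Suc.IH doubling_mem)
  then show ?case
    using observable_doubling_near_0[OF Suc.prems(1) le]
    by (simp add: window_sum_Suc window_factor_Suc algebra_simps)
qed

text \<open>Induction on the window length. If the first point is near 0, the whole sum is a
  multiple of its first term; otherwise the first term is bounded by a constant and the induction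
  hypothesis covers the rest. \<open>C\<close> depends on neither \<open>y\<close> nor
  \<open>m\<close>.\<close>

lemma window_sum_le:
  assumes "\<alpha> > 0"
  obtains C where "\<And>y m. \<lbrakk>y \<in> {0..<1}; m \<ge> 0; \<And>i. i < k \<Longrightarrow> observable \<alpha> ((doubling ^^ i) y) \<le> m\<rbrakk>
    \<Longrightarrow> window_sum \<alpha> k y \<le> window_factor \<alpha> k * m + C"
proof -
  have "\<exists>C\<ge>0. \<forall>y m. y \<in> {0..<1} \<longrightarrow> m \<ge> 0 \<longrightarrow> (\<forall>i<k. observable \<alpha> ((doubling ^^ i) y) \<le> m)
      \<longrightarrow> window_sum \<alpha> k y \<le> window_factor \<alpha> k * m + C"
  proof (induction k)
    case 0
    then show ?case by (auto simp: window_factor_def window_sum_def)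
  next
    case (Suc k)
    then obtain C where C: "C \<ge> 0" "\<And>y m. y \<in> {0..<1} \<Longrightarrow> m \<ge> 0 \<Longrightarrow>
        (\<And>i. i < k \<Longrightarrow> observable \<alpha> ((doubling ^^ i) y) \<le> m) \<Longrightarrow>
        window_sum \<alpha> k y \<le> window_factor \<alpha> k * m + C"
      by blast
    \<comment> \<open>The value of the observable at the distance up to which
      \<open>window_sum_near_0\<close> applies to windows of length \<open>Suc k\<close>.\<close>
    define D where "D = (1 / 2 ^ Suc (Suc k)) powr (- \<alpha>)"
    have D: "D \<ge> 0" by (simp add: D_def)
    have mono: "window_factor \<alpha> k \<le> window_factor \<alpha> (Suc k)"
      by (simp add: window_factor_def)
    have "window_sum \<alpha> (Suc k) y \<le> window_factor \<alpha> (Suc k) * m + (C + D)"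
      if y: "y \<in> {0..<1}" and m: "m \<ge> 0"
        and le: "\<And>i. i < Suc k \<Longrightarrow> observable \<alpha> ((doubling ^^ i) y) \<le> m" for y m
    proof (cases "min y (1 - y) \<le> 1 / 2 ^ Suc (Suc k)")
      case True
      have "window_factor \<alpha> (Suc k) * observable \<alpha> y \<le> window_factor \<alpha> (Suc k) * m"
        using le[of 0] window_factor_ge_1[of "Suc k" \<alpha>] by (intro mult_left_mono) auto
      then show ?thesis
        using window_sum_near_0[OF y True] C(1) D by simp
    next
      case False
      then have "observable \<alpha> y \<le> D"
        unfolding observable_eq[OF y] D_def using assms by (intro powr_mono2') auto
      moreover have "window_sum \<alpha> k (doubling y) \<le> window_factor \<alpha> k * m + C"
      proof (rule C(2)[OF doubling_mem m])
        show "observable \<alpha> ((doubling ^^ i) (doubling y)) \<le> m" if "i < k" for i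
          using le[of "Suc i"] that by (simp add: funpow_Suc_right del: funpow.simps)
      qed
      moreover have "window_factor \<alpha> k * m \<le> window_factor \<alpha> (Suc k) * m"
        using mono m by (rule mult_right_mono)
      ultimately show ?thesis by (simp add: window_sum_Suc)
    qed
    then show ?case using C(1) D by (intro exI[of _ "C + D"]) auto
  qed
  then show ?thesis using that by blast
qed

section \<open>Pathwise comparison of the two maxima\<close>

lemma max_process_le_iff:
  "max_process \<alpha> n x \<le> u \<longleftrightarrow> (\<forall>j\<le>n. observable \<alpha> ((doubling ^^ j) x) \<le> u)"
  unfolding max_process_def by (subst Max_le_iff) auto

lemma block_max_process_le_iff:
  "block_max_process \<alpha> k n x \<le> u \<longleftrightarrow>
    (\<forall>j\<le>n. window_sum \<alpha> k ((doubling ^^ j) x) / real k \<le> u)"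
  unfolding block_max_process_def by (subst Max_le_iff) (auto simp: window_average_eq)

text \<open>The window starting at time \<open>j\<close> alone has sum at least
  \<open>window_factor \<alpha> k\<close> times the observable at time \<open>j\<close>.\<close>

lemma max_process_le_block_max_process:
  assumes "\<alpha> > 0" "k \<ge> 1" "x \<in> {0..<1}" "\<And>j. (doubling ^^ j) x \<noteq> 0"
    and "block_max_process \<alpha> k n x \<le> window_factor \<alpha> k / real k * u"
  shows "max_process \<alpha> n x \<le> u"
  unfolding max_process_le_iff
proof (intro allI impI)
  fix j assume j: "j \<le> n"
  let ?y = "(doubling ^^ j) x"
  have "(doubling ^^ i) ?y \<noteq> 0" for i
    using assms(4)[of "i + j"] by (simp add: funpow_add)
  then have "window_factor \<alpha> k * observable \<alpha> ?y \<le> window_sum \<alpha> k ?y"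
    by (intro window_sum_ge assms(1) doubling_funpow_mem assms(3))
  also have "\<dots> \<le> window_factor \<alpha> k * u"
    using assms(2,5) j by (auto simp: block_max_process_le_iff field_simps)
  finally show "observable \<alpha> ?y \<le> u"
    using window_factor_ge_1[OF assms(2), of \<alpha>] by simp
qed

lemma measure_block_max_process_le:
  assumes "\<alpha> > 0" "k \<ge> 1"
  shows "measure circle_measure
      {x\<in>space circle_measure. block_max_process \<alpha> k n x \<le> window_factor \<alpha> k / real k * u}
    \<le> measure circle_measure {x\<in>space circle_measure. max_process \<alpha> n x \<le> u}"
proof (rule circle.finite_measure_mono_AE)
  show "AE x in circle_measure.
      x \<in> {x\<in>space circle_measure. block_max_process \<alpha> k n x \<le> window_factor \<alpha> k / real k * u} \<longrightarrow>
      x \<in> {x\<in>space circle_measure. max_process \<alpha> n x \<le> u}"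
    using AE_orbit_nonzero
    by eventually_elim (use max_process_le_block_max_process[OF assms] in auto)
  have [measurable]: "max_process \<alpha> n \<in> borel_measurable circle_measure"
    by (intro borel_measurable_circle_measure borel_measurable_max_process)
  show "{x\<in>space circle_measure. max_process \<alpha> n x \<le> u} \<in> sets circle_measure"
    by measurable
qed

text \<open>The last windows see \<open>k - 1\<close> orbit points beyond time \<open>n\<close>; they account for the subtracted term.\<close>

lemma measure_block_max_process_ge:
  assumes "\<alpha> > 0" "k \<ge> 1"
  obtains C where "\<And>n u v. v \<ge> 0 \<Longrightarrow> v + C \<le> u \<Longrightarrow>
    measure circle_measure {x\<in>space circle_measure. max_process \<alpha> n x \<le> v}
      - real k * measure circle_measure {x\<in>space circle_measure. observable \<alpha> x > v}
    \<le> measure circle_measure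
      {x\<in>space circle_measure. block_max_process \<alpha> k n x \<le> window_factor \<alpha> k / real k * u}"
proof -
  let ?S = "window_factor \<alpha> k"
  have S: "?S \<ge> 1" by (rule window_factor_ge_1[OF assms(2)])
  obtain C where C: "\<And>y m. \<lbrakk>y \<in> {0..<1}; m \<ge> 0;
      \<And>i. i < k \<Longrightarrow> observable \<alpha> ((doubling ^^ i) y) \<le> m\<rbrakk>
    \<Longrightarrow> window_sum \<alpha> k y \<le> ?S * m + C"
    using window_sum_le[OF assms(1), of k] by blast
  have "measure circle_measure {x\<in>space circle_measure. max_process \<alpha> n x \<le> v}
      - real k * measure circle_measure {x\<in>space circle_measure. observable \<alpha> x > v}
    \<le> measure circle_measure
      {x\<in>space circle_measure. block_max_process \<alpha> k n x \<le> ?S / real k * u}"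
    if v: "v \<ge> 0" and u: "v + C / ?S \<le> u" for n u v
  proof -
    let ?A = "{x\<in>space circle_measure. max_process \<alpha> n x \<le> v}"
    let ?B = "{x\<in>space circle_measure. block_max_process \<alpha> k n x \<le> ?S / real k * u}"
    let ?U = "{x\<in>space circle_measure. observable \<alpha> x > v}"
    \<comment> \<open>Exceedances of \<open>v\<close> at the times n, ..., n + k - 1; windows
      starting no later than \<open>n\<close> end by time n + k - 1.\<close>
    let ?L = "\<lambda>i. {x\<in>space circle_measure. observable \<alpha> ((doubling ^^ (n + i)) x) > v}"
    have [measurable]: "max_process \<alpha> n \<in> borel_measurable circle_measure"
      "block_max_process \<alpha> k n \<in> borel_measurable circle_measure"
      by (intro borel_measurable_circle_measure borel_measurable_max_process
          borel_measurable_block_max_process)+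
    have [measurable]: "(\<lambda>x. observable \<alpha> ((doubling ^^ (n + i)) x)) \<in> borel_measurable circle_measure" for i
      by (intro borel_measurable_circle_measure) measurable
    have A: "?A \<in> sets circle_measure" and B: "?B \<in> sets circle_measure"
      and L: "?L i \<in> sets circle_measure" for i
      by measurable
    \<comment> \<open>Off the events \<open>?L i\<close> all observations before time n + k are at
      most \<open>v\<close>, so \<open>window_sum_le\<close> bounds every window that starts by time
      \<open>n\<close>.\<close>
    have incl: "?A \<subseteq> ?B \<union> (\<Union>i<k. ?L i)"
    proof
      fix x assume x: "x \<in> ?A"
      show "x \<in> ?B \<union> (\<Union>i<k. ?L i)"
      proof (rule ccontr)
        assume not: "x \<notin> ?B \<union> (\<Union>i<k. ?L i)"
        have le: "observable \<alpha> ((doubling ^^ j) x) \<le> v" if j: "j < n + k" for j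
        proof (cases "j \<le> n")
          case True
          then show ?thesis using x by (auto simp: max_process_le_iff)
        next
          case False
          then obtain i where i: "j = n + i" "i < k"
            using j less_imp_add_positive[of n j] by force
          then have "x \<notin> ?L i" using not by blast
          then show ?thesis using x i(1) by (simp add: not_less)
        qed
        have "window_sum \<alpha> k ((doubling ^^ j) x) / real k \<le> ?S / real k * u" if "j \<le> n" for j
        proof -
          have "window_sum \<alpha> k ((doubling ^^ j) x) \<le> ?S * v + C"
          proof (rule C[OF _ v])
            show "(doubling ^^ j) x \<in> {0..<1}" using x by (intro doubling_funpow_mem) auto
            show "observable \<alpha> ((doubling ^^ i) ((doubling ^^ j) x)) \<le> v" if "i < k" for i
              using le[of "i + j"] that \<open>j \<le> n\<close> by (simp add: funpow_add)
          qed
          also have "\<dots> = ?S * (v + C / ?S)" using S by (simp add: field_simps)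
          also have "\<dots> \<le> ?S * u" using S u by (intro mult_left_mono) auto
          finally show ?thesis using assms(2) by (simp add: divide_right_mono)
        qed
        then have "x \<in> ?B" using x by (simp add: block_max_process_le_iff)
        then show False using not by simp
      qed
    qed
    \<comment> \<open>Invariance makes the late exceedances as likely as an exceedance at time
      0.\<close>
    have inv: "measure circle_measure (?L i) = measure circle_measure ?U" for i
    proof -
      have "{y. observable \<alpha> y > v} \<in> sets borel" by measurable
      from measure_doubling_funpow_vimage[OF this, of "n + i"]
      show ?thesis by (simp add: Int_def)
    qed
    have "measure circle_measure ?A \<le> measure circle_measure (?B \<union> (\<Union>i<k. ?L i))"
      by (intro circle.finite_measure_mono incl sets.Un B sets.finite_UN L) auto
    also have "\<dots> \<le> measure circle_measure ?B + measure circle_measure (\<Union>i<k. ?L i)"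
      by (intro measure_Un_le B sets.finite_UN L) auto
    also have "measure circle_measure (\<Union>i<k. ?L i) \<le> (\<Sum>i<k. measure circle_measure (?L i))"
      by (intro circle.finite_measure_subadditive_finite) (use L in auto)
    also have "\<dots> = real k * measure circle_measure ?U" by (simp only: inv) simp
    finally show ?thesis by simp
  qed
  \<comment> \<open>The error \<open>C\<close> of the window sum is divided by \<open>?S\<close>
    because levels are measured on the scale of the observable.\<close>
  then show ?thesis using that[of "C / ?S"] by blast
qed

section \<open>Divergence of the normalising constants\<close>

text \<open>The exceedance sets of integer levels decrease to the empty set, as the observable is
  finite everywhere; a general \<open>u\<close> eventually passes each integer level.\<close>

lemma measure_observable_gt_tendsto_0:
  assumes "filterlim u at_top sequentially"
  shows "(\<lambda>n. measure circle_measure {x\<in>space circle_measure. observable \<alpha> x > u n}) \<longlonglongrightarrow> 0"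
proof -
  let ?E = "\<lambda>n::nat. {x\<in>space circle_measure. observable \<alpha> x > real n}"
  have [measurable]: "observable \<alpha> \<in> borel_measurable circle_measure"
    by (intro borel_measurable_circle_measure) measurable
  have sets: "{x\<in>space circle_measure. observable \<alpha> x > v} \<in> sets circle_measure" for v
    by measurable
  have "(\<Inter>n. ?E n) = {}"
  proof -
    have "\<exists>n. \<not> observable \<alpha> x > real n" for x
      using reals_Archimedean2[of "observable \<alpha> x"] by (auto simp: not_less intro: less_imp_le)
    then show ?thesis by blast
  qed
  moreover have "(\<lambda>n. measure circle_measure (?E n)) \<longlonglongrightarrow> measure circle_measure (\<Inter>n. ?E n)"
    by (intro circle.finite_Lim_measure_decseq decseq_SucI) (use sets in auto)
  ultimately have lim: "(\<lambda>n. measure circle_measure (?E n)) \<longlonglongrightarrow> 0" by simp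
  show ?thesis
  proof (rule LIMSEQ_I)
    fix r :: real assume "r > 0"
    then obtain m where m: "measure circle_measure (?E m) < r"
      using LIMSEQ_D[OF lim, of r] by auto
    have "\<forall>\<^sub>F n in sequentially. u n \<ge> real m"
      using assms by (simp add: filterlim_at_top)
    then obtain n0 where n0: "\<And>n. n \<ge> n0 \<Longrightarrow> u n \<ge> real m"
      by (auto simp: eventually_sequentially)
    have "measure circle_measure {x\<in>space circle_measure. observable \<alpha> x > u n} < r" if "n \<ge> n0" for n
      by (rule le_less_trans[OF circle.finite_measure_mono m]) (use sets n0[OF that] in auto)
    then show "\<exists>n0. \<forall>n\<ge>n0.
        norm (measure circle_measure {x\<in>space circle_measure. observable \<alpha> x > u n} - 0) < r"
      by auto
  qed
qed

lemma observable_gt_near_0: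
  assumes "\<alpha> > 0"
  obtains p :: nat where "\<And>x. 0 < x \<Longrightarrow> x < 1 / 2 ^ p \<Longrightarrow> observable \<alpha> x > u"
proof -
  \<comment> \<open>Truncation at 1 makes the level positive and its inverse power at most
    1.\<close>
  define w where "w = max u 1"
  have w: "w \<ge> 1" by (simp add: w_def)
  \<comment> \<open>The division by 2 forces \<open>x < 1/2\<close>, where the circle distance to 0
    is \<open>x\<close> itself.\<close>
  obtain p :: nat where p: "(1/2) ^ p < w powr (- 1 / \<alpha>) / 2"
    using real_arch_pow_inv[of "w powr (- 1 / \<alpha>) / 2" "1/2"] w by auto
  have w1: "w powr (- 1 / \<alpha>) \<le> 1"
    using assms powr_mono2'[of "- 1 / \<alpha>" 1 w] w by simp
  have "observable \<alpha> x > u" if "0 < x" "x < 1 / 2 ^ p" for x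
  proof -
    have x: "x < w powr (- 1 / \<alpha>) / 2" using p that by (simp add: power_divide)
    then have "x < 1/2" using w1 by linarith
    have "w = (w powr (- 1 / \<alpha>)) powr (- \<alpha>)"
      using assms by (simp add: powr_powr w_def)
    also have "\<dots> < x powr (- \<alpha>)"
      using assms x that by (intro powr_less_mono2_neg) auto
    also have "\<dots> = observable \<alpha> x"
      using that \<open>x < 1/2\<close> by (simp add: observable_eq min_def)
    finally show ?thesis by (simp add: w_def)
  qed
  then show ?thesis using that by blast
qed

text \<open>The measures decrease to a limit \<open>l\<close>. Prolonging the orbit backwards by
  \<open>p\<close> steps removes a fixed proportion of the set, namely the starts near 0, so
  \<open>l\<close> is at most \<open>(1 - 1 / 2 ^ p) * l\<close> and must vanish.\<close>

lemma measure_max_process_le_tendsto_0: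
  assumes "\<alpha> > 0"
  shows "(\<lambda>n. measure circle_measure {x\<in>space circle_measure. max_process \<alpha> n x \<le> u}) \<longlonglongrightarrow> 0"
proof -
  define A where "A = (\<lambda>n. {x\<in>{0..<1}. max_process \<alpha> n x \<le> u})"
  have [measurable]: "max_process \<alpha> n \<in> borel_measurable borel" for n
    by (rule borel_measurable_max_process)
  have A_borel [measurable]: "A n \<in> sets borel" for n unfolding A_def by measurable
  have A_sub: "A n \<subseteq> {0..<1}" for n by (auto simp: A_def)
  have A_sets: "A n \<in> sets circle_measure" for n
    by (intro sets_circle_measure_borel A_borel A_sub)
  have dec: "decseq A"
    by (rule decseq_SucI) (auto simp: A_def max_process_le_iff)
  define l where "l = measure circle_measure (\<Inter>n. A n)"
  have lim: "(\<lambda>n. measure circle_measure (A n)) \<longlonglongrightarrow> l"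
    unfolding l_def by (rule circle.finite_Lim_measure_decseq[OF _ dec]) (use A_sets in auto)
  obtain p where p: "\<And>x. 0 < x \<Longrightarrow> x < 1 / 2 ^ p \<Longrightarrow> observable \<alpha> x > u"
    using observable_gt_near_0[OF assms] by blast
  \<comment> \<open>Points of \<open>A n\<close> pulled back along the branch of \<open>doubling ^^ p\<close> at 0 start too close to 0.\<close>
  have rec: "measure circle_measure (A (n + p)) \<le> (1 - 1 / 2 ^ p) * measure circle_measure (A n)" for n
  proof -
    let ?P = "{x\<in>{0..<1}. (doubling ^^ p) x \<in> A n}"
    \<comment> \<open>The part of the preimage on the first branch of the iterate, a copy of
      \<open>A n\<close> scaled by \<open>1 / 2 ^ p\<close>.\<close>
    define Q where "Q = ?P \<inter> {0..<1 / 2 ^ p}"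
    have le1: "(1::real) / 2 ^ p \<le> 1" by simp
    have P: "?P \<in> sets circle_measure"
      by (rule sets_circle_measure_borel) (measurable, auto)
    have Q: "Q \<in> sets circle_measure"
      unfolding Q_def by (rule sets_circle_measure_borel) (measurable, auto)
    have "Q = (\<lambda>x. 1 / 2 ^ p * x + 0) ` A n"
    proof (intro set_eqI iffI)
      fix x assume "x \<in> Q"
      then show "x \<in> (\<lambda>x. 1 / 2 ^ p * x + 0) ` A n"
        by (intro image_eqI[of _ _ "2 ^ p * x"]) (auto simp: doubling_funpow_near_0 Q_def)
    next
      fix x assume "x \<in> (\<lambda>x. 1 / 2 ^ p * x + 0) ` A n"
      then obtain y where y: "y \<in> A n" "x = y / 2 ^ p" by auto
      have "0 \<le> y" "y < 1" using A_sub y(1) by force+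
      then have x: "0 \<le> x" "x < 1 / 2 ^ p"
        unfolding y(2) by (auto simp: divide_strict_right_mono)
      then have "(doubling ^^ p) x = y"
        using doubling_funpow_near_0[OF x] by (simp add: y(2))
      moreover have "x < 1" using x le1 by linarith
      ultimately show "x \<in> Q" using x y(1) by (auto simp: Q_def)
    qed
    then have "measure lebesgue Q = \<bar>1 / 2 ^ p\<bar> * measure lebesgue (A n)"
      by (simp only: measure_lebesgue_real_affine)
    moreover have "Q \<subseteq> {0..<1}" by (auto simp: Q_def)
    ultimately have Qm: "measure circle_measure Q = 1 / 2 ^ p * measure circle_measure (A n)"
      by (simp add: measure_circle_measure A_sub)
    \<comment> \<open>The point 0 is split off because the observable has its default value 0 there,
      which need not exceed \<open>u\<close>.\<close>
    have "A (n + p) \<subseteq> (?P - Q) \<union> {0}"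
    proof
      fix x assume x: "x \<in> A (n + p)"
      then have le: "observable \<alpha> ((doubling ^^ j) x) \<le> u" if "j \<le> n + p" for j
        using that by (auto simp: A_def max_process_le_iff)
      have x01: "x \<in> {0..<1}" using x A_sub by blast
      have "(doubling ^^ p) x \<in> A n"
        unfolding A_def mem_Collect_eq max_process_le_iff
      proof (intro conjI allI impI)
        show "(doubling ^^ p) x \<in> {0..<1}" by (rule doubling_funpow_mem[OF x01])
        show "observable \<alpha> ((doubling ^^ j) ((doubling ^^ p) x)) \<le> u" if "j \<le> n" for j
          using le[of "j + p"] that by (simp add: funpow_add)
      qed
      moreover have "x \<notin> Q" if "x \<noteq> 0"
        using p[of x] le[of 0] that by (auto simp: Q_def)
      ultimately show "x \<in> (?P - Q) \<union> {0}" using x01 by auto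
    qed
    then have "measure circle_measure (A (n + p)) \<le> measure circle_measure ((?P - Q) \<union> {0})"
      by (intro circle.finite_measure_mono sets.Un sets.Diff P Q)
        (auto intro: sets_circle_measure_borel)
    also have "\<dots> = measure circle_measure (?P - Q)"
      by (intro measure_Un_null_set sets.Diff P Q null_sets_circle_measure_singleton) auto
    also have "\<dots> = measure circle_measure ?P - measure circle_measure Q"
      by (intro circle.finite_measure_Diff P Q) (auto simp: Q_def)
    also have "measure circle_measure ?P = measure circle_measure (A n)"
      using measure_doubling_funpow_vimage[OF A_borel, of p n] A_sub[of n]
      by (simp add: Int_absorb1)
    finally show ?thesis using Qm by (simp add: algebra_simps)
  qed
  have "l \<le> (1 - 1 / 2 ^ p) * l"
    using rec
    by (intro LIMSEQ_le[OF LIMSEQ_ignore_initial_segment[OF lim] tendsto_mult_left[OF lim]]) auto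
  then have "l / 2 ^ p \<le> 0" by (simp add: algebra_simps)
  then have "l \<le> 0" by (simp add: field_simps)
  then have "l = 0" using measure_nonneg[of circle_measure] by (simp add: l_def order_antisym)
  then show ?thesis using lim by (simp add: A_def)
qed

text \<open>If \<open>c n\<close> were below a fixed \<open>K\<close> for infinitely many
  \<open>n\<close>, the probabilities would be at most those for level \<open>K\<close> along these
  \<open>n\<close>, which tend to 0 and contradict \<open>L > 0\<close>.\<close>

lemma normalising_constants_at_top:
  assumes "\<alpha> > 0" "L > 0"
    and lim: "(\<lambda>n. measure circle_measure {x\<in>space circle_measure. max_process \<alpha> n x \<le> c n}) \<longlonglongrightarrow> L"
  shows "filterlim c at_top sequentially"
  unfolding filterlim_at_top
proof
  fix K
  have [measurable]: "max_process \<alpha> n \<in> borel_measurable circle_measure" for n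
    by (intro borel_measurable_circle_measure borel_measurable_max_process)
  have sets: "{x\<in>space circle_measure. max_process \<alpha> n x \<le> K} \<in> sets circle_measure" for n
    by measurable
  have "\<forall>\<^sub>F n in sequentially.
      measure circle_measure {x\<in>space circle_measure. max_process \<alpha> n x \<le> K} < L / 2"
    using measure_max_process_le_tendsto_0[OF assms(1), of K] assms(2)
    by (intro order_tendstoD(2)) auto
  moreover have "\<forall>\<^sub>F n in sequentially.
      L / 2 < measure circle_measure {x\<in>space circle_measure. max_process \<alpha> n x \<le> c n}"
    using lim assms(2) by (intro order_tendstoD(1)) auto
  ultimately show "\<forall>\<^sub>F n in sequentially. K \<le> c n"
  proof eventually_elim
    case (elim n)
    show ?case
    proof (rule ccontr)
      assume "\<not> K \<le> c n"
      then have "measure circle_measure {x\<in>space circle_measure. max_process \<alpha> n x \<le> c n}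
          \<le> measure circle_measure {x\<in>space circle_measure. max_process \<alpha> n x \<le> K}"
        by (intro circle.finite_measure_mono sets) auto
      then show False using elim by linarith
    qed
  qed
qed

section \<open>Transfer of the limit law\<close>

lemma frechet_cdf_isCont: "t > 0 \<Longrightarrow> isCont (\<lambda>t. frechet_cdf \<xi> t powr \<theta>) t"
proof -
  assume t: "t > 0"
  have "isCont (\<lambda>t. exp (- (t powr (- 1 / \<xi>))) powr \<theta>) t"
    using t by (intro continuous_intros) auto
  moreover have "\<forall>\<^sub>F s in nhds t. frechet_cdf \<xi> s powr \<theta> = exp (- (s powr (- 1 / \<xi>))) powr \<theta>"
    using eventually_nhds_in_open[of "{0<..}" t] t
    by (auto elim!: eventually_mono simp: frechet_cdf_def)
  ultimately show ?thesis by (simp add: isCont_cong)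
qed

text \<open>A squeeze: the upper bound is immediate at level \<open>t\<close>. For the lower one,
  the law of the maximum is taken at a slightly smaller \<open>s\<close>; the gap
  \<open>c n * (t - s)\<close> absorbs the additive constant, and the end term vanishes because
  \<open>c n * s\<close> diverges.\<close>

lemma block_max_process_limit:
  fixes F :: "real \<Rightarrow> real"
  assumes "\<alpha> > 0" "k \<ge> 1" and t: "t > 0" and cont: "isCont F t"
    and c: "\<And>n. c n > 0" "filterlim c at_top sequentially"
    and lim: "\<And>t. t > 0 \<Longrightarrow>
      (\<lambda>n. measure circle_measure {x\<in>space circle_measure. max_process \<alpha> n x \<le> c n * t}) \<longlonglongrightarrow> F t"
  shows "(\<lambda>n. measure circle_measure {x\<in>space circle_measure.
      block_max_process \<alpha> k n x \<le> window_factor \<alpha> k / real k * (c n * t)}) \<longlonglongrightarrow> F t"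
proof (rule order_tendstoI)
  let ?B = "\<lambda>n. measure circle_measure {x\<in>space circle_measure.
      block_max_process \<alpha> k n x \<le> window_factor \<alpha> k / real k * (c n * t)}"
  let ?M = "\<lambda>t n. measure circle_measure {x\<in>space circle_measure. max_process \<alpha> n x \<le> c n * t}"
  {
    fix a assume "F t < a"
    then have "\<forall>\<^sub>F n in sequentially. ?M t n < a"
      by (rule order_tendstoD(2)[OF lim[OF t]])
    then show "\<forall>\<^sub>F n in sequentially. ?B n < a"
      by eventually_elim (rule le_less_trans[OF measure_block_max_process_le[OF assms(1,2)]])
  next
    fix a assume "a < F t"
    then have "\<forall>\<^sub>F s in at t. a < F s"
      using cont by (intro order_tendstoD(1)) (auto simp: isCont_def)
    then obtain d where d: "d > 0" "\<And>s. s \<noteq> t \<Longrightarrow> dist s t < d \<Longrightarrow> a < F s"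
      by (auto simp: eventually_at)
    \<comment> \<open>The first term keeps \<open>s\<close> positive, the second keeps it within
      \<open>d\<close> of \<open>t\<close>; both are below \<open>t\<close>.\<close>
    define s where "s = max (t / 2) (t - d / 2)"
    have s: "0 < s" "s < t" "a < F s"
      using t d(1) d(2)[of s] by (auto simp: s_def dist_real_def max_def)
    obtain C where C: "\<And>n u v. v \<ge> 0 \<Longrightarrow> v + C \<le> u \<Longrightarrow>
      measure circle_measure {x\<in>space circle_measure. max_process \<alpha> n x \<le> v}
        - real k * measure circle_measure {x\<in>space circle_measure. observable \<alpha> x > v}
      \<le> measure circle_measure
        {x\<in>space circle_measure. block_max_process \<alpha> k n x \<le> window_factor \<alpha> k / real k * u}"
      using measure_block_max_process_ge[OF assms(1,2)] by blast
    let ?U = "\<lambda>n. measure circle_measure {x\<in>space circle_measure. observable \<alpha> x > c n * s}"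
    have "filterlim (\<lambda>n. c n * s) at_top sequentially"
      using filterlim_at_top_mult_tendsto_pos[OF tendsto_const s(1) c(2)] .
    then have "?U \<longlonglongrightarrow> 0" by (rule measure_observable_gt_tendsto_0)
    then have "(\<lambda>n. ?M s n - real k * ?U n) \<longlonglongrightarrow> F s - real k * 0"
      by (intro tendsto_intros lim s)
    then have "\<forall>\<^sub>F n in sequentially. a < ?M s n - real k * ?U n"
      using s(3) by (intro order_tendstoD(1)) auto
    \<comment> \<open>Equivalent to \<open>c n * s + C \<le> c n * t\<close>, the side condition on
      levels in \<open>C\<close>.\<close>
    moreover have "\<forall>\<^sub>F n in sequentially. C / (t - s) \<le> c n"
      using c(2) by (simp add: filterlim_at_top)
    ultimately show "\<forall>\<^sub>F n in sequentially. a < ?B n"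
    proof eventually_elim
      case (elim n)
      have "c n * s + C \<le> c n * t"
        using elim(2) s(2) by (simp add: field_simps)
      then have "?M s n - real k * ?U n \<le> ?B n"
        using c(1)[of n] s(1) by (intro C) auto
      then show ?case using elim(1) by linarith
    qed
  }
qed

text \<open>Serves to absorb a rescaling of the normalising constants into scale and location, which
  enter only through (z - m) / \<sigma>.\<close>

lemma gev_cdf_scale:
  assumes "r > 0"
  shows "gev_cdf \<xi> (r * \<sigma>) (r * m) z = gev_cdf \<xi> \<sigma> m (z / r)"
proof -
  have "z - r * m = r * (z / r - m)"
    using assms by (simp add: right_diff_distrib)
  then have "(z - r * m) / (r * \<sigma>) = (z / r - m) / \<sigma>"
    using assms by simp
  then show ?thesis by (simp add: gev_cdf_def)
qed

text \<open>The witnesses are \<open>r * c n\<close> with the exponent \<open>\<theta>\<close>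
  unchanged, so limit law and shape carry over and only scale and location are multiplied by
  \<open>r\<close>.\<close>

lemma has_gev_block_max_process:
  assumes "\<alpha> > 0" "k \<ge> 1" "has_gev N (max_process \<alpha>) \<xi> \<sigma> m"
  shows "has_gev N (block_max_process \<alpha> k) \<xi>
    (\<lambda>n. window_factor \<alpha> k * \<sigma> n / real k) (\<lambda>n. window_factor \<alpha> k * m n / real k)"
proof -
  obtain c \<theta> where \<xi>: "\<xi> > 0" and \<sigma>: "\<And>n. n \<ge> N \<Longrightarrow> \<sigma> n > 0"
    and c: "\<And>n. c n > 0" and \<theta>: "0 < \<theta>" "\<theta> \<le> 1"
    and lim: "\<And>t. t > 0 \<Longrightarrow> (\<lambda>n. measure circle_measure
        {x\<in>space circle_measure. max_process \<alpha> n x \<le> c n * t}) \<longlonglongrightarrow> frechet_cdf \<xi> t powr \<theta>"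
    and gev: "\<And>n z. n \<ge> N \<Longrightarrow> frechet_cdf \<xi> (z / c n) powr \<theta> = gev_cdf \<xi> (\<sigma> n) (m n) z"
    using assms(3) unfolding has_gev_def by blast
  define r where "r = window_factor \<alpha> k / real k"
  have r: "r > 0"
    using window_factor_ge_1[OF assms(2), of \<alpha>] assms(2) by (simp add: r_def)
  \<comment> \<open>Positivity of the limit at \<open>t = 1\<close> is what makes \<open>c\<close>
    diverge.\<close>
  have "frechet_cdf \<xi> 1 powr \<theta> > 0" by (simp add: frechet_cdf_def)
  then have c_top: "filterlim c at_top sequentially"
    by (rule normalising_constants_at_top[OF assms(1)]) (use lim[of 1] in simp)
  have "(\<lambda>n. measure circle_measure {x\<in>space circle_measure. block_max_process \<alpha> k n x \<le> r * c n * t})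
      \<longlonglongrightarrow> frechet_cdf \<xi> t powr \<theta>" if "t > 0" for t
    using block_max_process_limit[OF assms(1,2) that frechet_cdf_isCont[OF that] c c_top lim]
    by (simp add: r_def mult.assoc)
  moreover have "frechet_cdf \<xi> (z / (r * c n)) powr \<theta> = gev_cdf \<xi> (r * \<sigma> n) (r * m n) z"
    if "n \<ge> N" for n z
    using gev[OF that, of "z / r"] by (simp add: gev_cdf_scale[OF r])
  ultimately have "has_gev N (block_max_process \<alpha> k) \<xi> (\<lambda>n. r * \<sigma> n) (\<lambda>n. r * m n)"
    unfolding has_gev_def using \<xi> \<sigma> c \<theta> r
    by (intro conjI exI[of _ "\<lambda>n. r * c n"] exI[of _ \<theta>]) auto
  then show ?thesis by (simp add: r_def)
qed

theorem theorem8p1: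
  fixes \<alpha> :: real
  assumes "\<alpha> > 0"
  shows "\<exists>(c :: nat \<Rightarrow> real) c\<^sub>l c\<^sub>u. 0 < c\<^sub>l \<and> 0 < c\<^sub>u \<and>
           (\<forall>k\<ge>1. c\<^sub>l < c k \<and> c k < c\<^sub>u) \<and>
           (\<forall>k\<ge>1. \<forall>N \<xi>\<^sub>1 \<sigma>\<^sub>1 \<mu>\<^sub>1.
              has_gev N (max_process \<alpha>) \<xi>\<^sub>1 \<sigma>\<^sub>1 \<mu>\<^sub>1 \<longrightarrow>
              has_gev N (block_max_process \<alpha> k) \<xi>\<^sub>1
                (\<lambda>n. c k * \<sigma>\<^sub>1 n / real k) (\<lambda>n. c k * \<mu>\<^sub>1 n / real k))"
proof (intro exI conjI allI impI)
  \<comment> \<open>The lower bound is strict and the factor equals 1 at \<open>k = 1\<close>, so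
    the constant has to lie below 1.\<close>
  show "(0::real) < 1 / 2" by simp
  show "0 < 1 / (1 - 2 powr (- \<alpha>))"
    using assms powr_less_one[of 2 "-\<alpha>"] by simp
  show "1 / 2 < window_factor \<alpha> k" if "k \<ge> 1" for k
    using window_factor_ge_1[OF that, of \<alpha>] by linarith
  show "window_factor \<alpha> k < 1 / (1 - 2 powr (- \<alpha>))" for k
    by (rule window_factor_less[OF assms])
qed (rule has_gev_block_max_process[OF assms])

end
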